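(* Let $F$ be an oriented star of degree $4$ and let $H$ be a digraph such that $\{H, F\}$ is $\vec{\chi}$-finite. Then either $H$ is a transitive tournament, or $H = \Delta(TT_1, TT_m, TT_{m'})$ for some integers $m, m' \geq 1$.
   Context: All digraphs are finite, loopless, and between any two distinct vertices at most one of the two possible arcs is present. A digraph $D$ is $H$-free if no induced subdigraph of $D$ is isomorphic to $H$, and $\mathcal{F}$-free if it is $H$-free for every $H\in\mathcal{F}$. The dichromatic number $\vec{\chi}(D)$ is the least $k$ such that $V(D)$ can be partitioned into $k$ sets each inducing an acyclic subdigraph. A finite family $\mathcal{F}$ is $\vec{\chi}$-finite if there is a constant $c$ such that every $\mathcal{F}$-free digraph has dichromatic number at most $c$. An oriented star of degree $t$ is an orientation of $K_{1,t}$. A tournament is an orientation of a complete graph; it is transitive if acyclic, and $TT_k$ denotes the transitive tournament on $k$ vertices. For digraphs $D_1, D_2, D_3$, $\Delta(D_1,D_2,D_3)$ is the digraph obtained from the disjoint union $D_1+D_2+D_3$ by adding all arcs $d_id_j$ with $d_i\in V(D_i)$, $d_j \in V(D_j)$ and $(i,j)\in\{(1,2),(2,3),(3,1)\}$. *)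

theory Defs
  imports "Graph_Theory.Graph_Theory" "HOL-Library.Disjoint_Sets"
begin

text \<open>
  The locale \<^locale>\<open>pair_digraph\<close> gives finite loopless digraphs without parallel arcs, but still
  allows both arcs between two distinct vertices. The digraph with no vertices is allowed.
\<close>

definition oriented_digraph :: "'a pair_pre_digraph \<Rightarrow> bool" where
  "oriented_digraph D \<longleftrightarrow> pair_digraph D \<and> antisym (parcs D)"

text \<open>
  Acyclicity of a digraph is expressed by \<^const>\<open>acyclic\<close> on its arc relation.
\<close>

lemma acyclic_iff_no_cycle:
  assumes "pair_wf_digraph D"
  shows "acyclic (parcs D) \<longleftrightarrow> \<not> (\<exists>p. pre_digraph.cycle D p)"
proof -
  interpret pair_wf_digraph D by fact
  have "acyclic (parcs D) \<longleftrightarrow> \<not> (\<exists>u p. awalk u p u \<and> p \<noteq> [])"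
    using reachable1_awalk by (auto simp: acyclic_def)
  also have "\<dots> \<longleftrightarrow> \<not> (\<exists>p. cycle p)"
    using closed_w_imp_cycle unfolding closed_w_def cycle_def by blast
  finally show ?thesis .
qed

definition contains_induced :: "'a pair_pre_digraph \<Rightarrow> 'b pair_pre_digraph \<Rightarrow> bool" where
  "contains_induced D H \<longleftrightarrow>
     (\<exists>S \<subseteq> pverts D. digraph_iso (with_proj D \<restriction> S) (with_proj H))"

definition family_free :: "'b pair_pre_digraph set \<Rightarrow> 'a pair_pre_digraph \<Rightarrow> bool" where
  "family_free \<F> D \<longleftrightarrow> (\<forall>H \<in> \<F>. \<not> contains_induced D H)"

definition dichromatic_number :: "'a pair_pre_digraph \<Rightarrow> nat" where
  "dichromatic_number D =
     (LEAST k. \<exists>P. partition_on (pverts D) P \<and> card P = k \<and>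
        (\<forall>S \<in> P. acyclic (arcs_ends (with_proj D \<restriction> S))))"

text \<open>
  The vertex set of \<open>D\<close> is taken in \<^typ>\<open>nat\<close>: every finite digraph has an isomorphic copy there,
  while the members of \<open>\<F>\<close> may live on any vertex type.
\<close>

definition dichi_finite :: "'b pair_pre_digraph set \<Rightarrow> bool" where
  "dichi_finite \<F> \<longleftrightarrow> finite \<F> \<and>
     (\<exists>c. \<forall>D :: nat pair_pre_digraph.
        oriented_digraph D \<and> family_free \<F> D \<longrightarrow> dichromatic_number D \<le> c)"

text \<open>
  \<^const>\<open>mk_symmetric\<close> is the underlying undirected graph, given as a symmetric digraph, so an
  oriented digraph \<open>D\<close> is an orientation of \<open>mk_symmetric D\<close>.
\<close>

definition oriented_star :: "nat \<Rightarrow> 'a pair_pre_digraph \<Rightarrow> bool" where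
  "oriented_star t D \<longleftrightarrow>
     oriented_digraph D \<and> complete_bipartite_digraph 1 t (with_proj (mk_symmetric (with_proj D)))"

definition tournament :: "'a pair_pre_digraph \<Rightarrow> bool" where
  "tournament D \<longleftrightarrow>
     oriented_digraph D \<and> (\<exists>n. complete_digraph n (with_proj (mk_symmetric (with_proj D))))"

definition transitive_tournament :: "'a pair_pre_digraph \<Rightarrow> bool" where
  "transitive_tournament D \<longleftrightarrow> tournament D \<and> acyclic (parcs D)"

definition TT :: "nat \<Rightarrow> nat pair_pre_digraph" where
  "TT k = \<lparr> pverts = {..<k}, parcs = {(i, j). i < j \<and> j < k} \<rparr>"

definition Delta ::
  "'a pair_pre_digraph \<Rightarrow> 'b pair_pre_digraph \<Rightarrow> 'c pair_pre_digraph \<Rightarrow> ('a + 'b + 'c) pair_pre_digraph"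
where
  "Delta D1 D2 D3 =
     (let i1 = Inl; i2 = Inr \<circ> Inl; i3 = Inr \<circ> Inr;
          V1 = i1 ` pverts D1; V2 = i2 ` pverts D2; V3 = i3 ` pverts D3
      in \<lparr> pverts = V1 \<union> V2 \<union> V3,
           parcs = map_prod i1 i1 ` parcs D1 \<union> map_prod i2 i2 ` parcs D2 \<union> map_prod i3 i3 ` parcs D3
             \<union> V1 \<times> V2 \<union> V2 \<times> V3 \<union> V3 \<times> V1 \<rparr>)"

end

theory Submission
  imports Defs "HOL-Library.Ramsey" "HOL-Library.Countable"
begin

text \<open>
  Two families of digraphs contain no oriented star of degree 4 and have unbounded dichromatic number,
  so \<open>H\<close> embeds in a member of each. The first consists of tournaments iterating
  \<open>\<Delta>(1, D, D)\<close>, so \<open>H\<close> is a tournament; if \<open>H\<close> has a directed triangle, descending in the iteration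
  either gives a partition of \<open>H\<close> as \<open>\<Delta>(1, A, B)\<close> or finds a vertex dominating, or dominated by, a
  directed triangle. The second consists of orientations of line graphs of complete graphs, large
  dichromatic number following from Ramsey's theorem for triangles. There the in- and out-neighbourhood
  of a vertex contain no directed triangle, which rules out the second alternative and makes \<open>A\<close> and \<open>B\<close>
  transitive.
\<close>

section \<open>Induced embeddings and colourings without directed triangles\<close>

definition dicycle3 :: "'v rel \<Rightarrow> 'v \<Rightarrow> 'v \<Rightarrow> 'v \<Rightarrow> bool" where
  "dicycle3 E p q r \<longleftrightarrow> (p, q) \<in> E \<and> (q, r) \<in> E \<and> (r, p) \<in> E"

text \<open>The host is a bare vertex set and relation, so lists and pairs can serve as vertices
  without first being coded as natural numbers. The map runs from the pattern into the host,
  opposite to the isomorphism in \<open>contains_induced\<close>.\<close>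

definition embeds :: "'a pair_pre_digraph \<Rightarrow> 'v set \<Rightarrow> 'v rel \<Rightarrow> bool" where
  "embeds H V E \<longleftrightarrow> (\<exists>f. inj_on f (pverts H) \<and> f ` pverts H \<subseteq> V \<and>
     (\<forall>u \<in> pverts H. \<forall>v \<in> pverts H. (u, v) \<in> parcs H \<longleftrightarrow> (f u, f v) \<in> E))"

lemma digraph_iso_inducedE:
  assumes "digraph_iso (with_proj D \<restriction> S) (with_proj H)"
  obtains f where "bij_betw f S (pverts H)"
    and "\<And>u v. u \<in> S \<Longrightarrow> v \<in> S \<Longrightarrow> (u, v) \<in> parcs D \<longleftrightarrow> (f u, f v) \<in> parcs H"
proof -
  obtain h where iso: "pre_digraph.digraph_isomorphism (with_proj D \<restriction> S) h"
    and H: "with_proj H = app_iso h (with_proj D \<restriction> S)"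
    using assms unfolding digraph_iso_def by blast
  let ?f = "iso_verts h"
  have verts: "pverts H = ?f ` S"
    using arg_cong[OF H, of verts] by simp
  have arcs: "parcs H = iso_arcs h ` {e \<in> parcs D. fst e \<in> S \<and> snd e \<in> S}"
    using arg_cong[OF H, of arcs] by simp
  \<comment> \<open>Both digraphs have the projections as tail and head maps. This forces the arc
    map of \<open>h\<close> to act as the vertex map on both ends, so the vertex map alone
    determines the isomorphism.\<close>
  have ends: "iso_tail h = fst" "iso_head h = snd"
    using arg_cong[OF H, of tail] arg_cong[OF H, of head] by simp_all
  have inj: "inj_on ?f S"
    using iso by (simp add: pre_digraph.digraph_isomorphism_def)
  have arc: "iso_arcs h (u, v) = (?f u, ?f v)" if "(u, v) \<in> parcs D" "u \<in> S" "v \<in> S" for u v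
    using iso that by (auto simp: pre_digraph.digraph_isomorphism_def ends prod_eq_iff)
  show ?thesis
  proof
    show "bij_betw ?f S (pverts H)"
      using inj verts by (simp add: bij_betw_def)
    fix u v assume uv: "u \<in> S" "v \<in> S"
    show "(u, v) \<in> parcs D \<longleftrightarrow> (?f u, ?f v) \<in> parcs H"
    proof
      assume "(u, v) \<in> parcs D"
      then show "(?f u, ?f v) \<in> parcs H"
        unfolding arcs using arc uv by (force intro: rev_image_eqI)
    next
      assume "(?f u, ?f v) \<in> parcs H"
      then obtain u' v' where e: "(u', v') \<in> parcs D" "u' \<in> S" "v' \<in> S"
        and eq: "(?f u, ?f v) = iso_arcs h (u', v')"
        unfolding arcs by auto
      then have "u' = u" "v' = v"
        using arc[OF e] inj uv by (auto dest: inj_onD)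
      with e show "(u, v) \<in> parcs D" by simp
    qed
  qed
qed

lemma digraph_isoI:
  assumes "pair_wf_digraph G"
    and bij: "bij_betw f (pverts G) (pverts H)"
    and arcs: "\<And>u v. u \<in> pverts G \<Longrightarrow> v \<in> pverts G \<Longrightarrow> (u, v) \<in> parcs G \<longleftrightarrow> (f u, f v) \<in> parcs H"
    and "parcs H \<subseteq> pverts H \<times> pverts H"
  shows "digraph_iso (with_proj G) (with_proj H)"
proof -
  interpret pair_wf_digraph G by fact
  define h where "h = \<lparr> iso_verts = f, iso_arcs = map_prod f f, iso_head = snd, iso_tail = fst \<rparr>"
  have inj: "inj_on f (pverts G)" and img: "f ` pverts G = pverts H"
    using bij by (auto simp: bij_betw_def)
  have sub: "parcs G \<subseteq> pverts G \<times> pverts G"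
    using in_arcsD1 in_arcsD2 by auto
  have "inj_on (map_prod f f) (parcs G)"
    using map_prod_inj_on[OF inj inj] sub by (rule inj_on_subset)
  then have 1: "pre_digraph.digraph_isomorphism (with_proj G) h"
    using inj \<open>pair_wf_digraph G\<close>
    by (auto simp: pre_digraph.digraph_isomorphism_def h_def wf_digraph_wp_iff)
  have "parcs H = map_prod f f ` parcs G"
  proof (intro set_eqI iffI)
    fix e assume e: "e \<in> parcs H"
    then obtain u v where "u \<in> pverts G" "v \<in> pverts G" "e = (f u, f v)"
      using assms(4) img by (cases e) (auto, blast)
    then show "e \<in> map_prod f f ` parcs G"
      using arcs e by (auto intro: rev_image_eqI)
  next
    fix e assume "e \<in> map_prod f f ` parcs G"
    then show "e \<in> parcs H" using arcs sub by auto
  qed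
  then have "with_proj H = app_iso h (with_proj G)"
    using img by (simp add: app_iso_def h_def with_proj_def)
  with 1 show ?thesis unfolding digraph_iso_def by blast
qed

text \<open>The \<open>LEAST\<close> is attained because some partition qualifies: without loops,
  the partition into singletons has acyclic classes.\<close>

lemma dichromatic_partition:
  assumes "pair_digraph D"
  obtains P where "partition_on (pverts D) P" "card P = dichromatic_number D"
    "\<And>S. S \<in> P \<Longrightarrow> acyclic (arcs_ends (with_proj D \<restriction> S))"
proof -
  interpret pair_digraph D by fact
  let ?Q = "\<lambda>k. \<exists>P. partition_on (pverts D) P \<and> card P = k \<and>
        (\<forall>S \<in> P. acyclic (arcs_ends (with_proj D \<restriction> S)))"
  let ?P = "(\<lambda>x. {x}) ` pverts D"
  have "partition_on (pverts D) ?P"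
    by (auto simp: partition_on_def disjoint_def)
  moreover have "acyclic (arcs_ends (with_proj D \<restriction> {x}))" for x
  proof -
    have "arcs_ends (with_proj D \<restriction> {x}) = {}"
      using pair_no_loops by (force simp: arcs_ends_conv)
    then show ?thesis by (simp add: acyclic_def)
  qed
  ultimately have "?Q (card ?P)" by auto
  then have "?Q (dichromatic_number D)"
    unfolding dichromatic_number_def by (rule LeastI)
  with that show ?thesis by blast
qed

text \<open>Bounded dichromatic number enters the argument only in this weaker form: an acyclic
  class contains no directed triangle. Countability of the vertex type lets \<open>to_nat\<close>
  carry the digraph over to \<open>nat\<close>, and \<open>c\<close> is fixed before the
  digraph.\<close>

lemma dichi_finite_colouring:
  fixes \<F> :: "'a pair_pre_digraph set"
  assumes "dichi_finite \<F>"
  shows "\<exists>c. \<forall>(V :: 'v::countable set) E. finite V \<longrightarrow> E \<subseteq> V \<times> V \<longrightarrow> irrefl E \<longrightarrow> antisym E \<longrightarrow>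
      (\<forall>H \<in> \<F>. \<not> embeds H V E) \<longrightarrow>
      (\<exists>f. f ` V \<subseteq> {..<c :: nat} \<and>
        (\<forall>p q r. dicycle3 E p q r \<longrightarrow> \<not> (f p = f q \<and> f q = f r)))"
proof -
  obtain c where c: "dichromatic_number D \<le> c"
    if "oriented_digraph D" "family_free \<F> D" for D :: "nat pair_pre_digraph"
    using assms unfolding dichi_finite_def by blast
  show ?thesis
  proof (intro exI[of _ c] allI impI)
    fix V :: "'v set" and E
    assume V: "finite V" and E: "E \<subseteq> V \<times> V" "irrefl E" "antisym E"
      and free: "\<forall>H \<in> \<F>. \<not> embeds H V E"
    define D where "D = \<lparr> pverts = to_nat ` V, parcs = map_prod to_nat to_nat ` E \<rparr>"
    have arc: "(to_nat x, to_nat y) \<in> parcs D \<longleftrightarrow> (x, y) \<in> E" for x y :: 'v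
      by (auto simp: D_def)
    have "finite E" using V E(1) finite_subset by blast
    then have pD: "pair_digraph D"
      using V E(1,2) by unfold_locales (auto simp: D_def irrefl_def)
    moreover have "antisym (parcs D)"
      using E(3) by (auto simp: D_def antisym_def)
    ultimately have "oriented_digraph D"
      by (simp add: oriented_digraph_def)
    moreover have "\<not> contains_induced D H" if "H \<in> \<F>" for H
    proof
      assume "contains_induced D H"
      then obtain S where S: "S \<subseteq> pverts D" and "digraph_iso (with_proj D \<restriction> S) (with_proj H)"
        unfolding contains_induced_def by blast
      then obtain f where f: "bij_betw f S (pverts H)"
        and arcs: "\<And>u v. u \<in> S \<Longrightarrow> v \<in> S \<Longrightarrow> (u, v) \<in> parcs D \<longleftrightarrow> (f u, f v) \<in> parcs H"
        using digraph_iso_inducedE by blast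
      \<comment> \<open>\<open>f\<close> leads from the copy in \<open>D\<close> to
        \<open>H\<close>, so the embedding inverts it and then decodes the natural number.\<close>
      let ?i = "inv_into S f" and ?g = "\<lambda>u. from_nat (inv_into S f u) :: 'v"
      have iS: "?i u \<in> S" and fi: "f (?i u) = u" if "u \<in> pverts H" for u
        using f that by (auto simp: bij_betw_def f_inv_into_f inv_into_into)
      have to: "to_nat (?g u) = ?i u" and gV: "?g u \<in> V" if "u \<in> pverts H" for u
        using iS[OF that] S by (auto simp: D_def)
      have "inj_on ?g (pverts H)"
        by (rule inj_onI) (metis to fi)
      moreover have "(u, v) \<in> parcs H \<longleftrightarrow> (?g u, ?g v) \<in> E"
        if "u \<in> pverts H" "v \<in> pverts H" for u v
        using arcs[OF iS[OF that(1)] iS[OF that(2)]] that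
        by (simp add: fi to flip: arc)
      ultimately have "embeds H V E"
        unfolding embeds_def using gV by blast
      with free that show False by blast
    qed
    ultimately have le: "dichromatic_number D \<le> c"
      using c unfolding family_free_def by blast
    obtain P where P: "partition_on (pverts D) P" and card: "card P = dichromatic_number D"
      and acyc: "\<And>S. S \<in> P \<Longrightarrow> acyclic (arcs_ends (with_proj D \<restriction> S))"
      using dichromatic_partition[OF pD] by blast
    have "finite P"
      using P V by (auto simp: D_def intro: finite_elements)
    \<comment> \<open>Numbering the classes turns the partition into a colouring: the colour of
      \<open>v\<close> is the number of its class \<open>part v\<close>.\<close>
    then obtain g where g: "bij_betw g P {..<card P}"
      using ex_bij_betw_finite_nat[of P] by (auto simp: atLeast0LessThan)
    have "\<forall>v \<in> V. \<exists>S \<in> P. to_nat v \<in> S"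
      using P by (auto simp: D_def partition_on_def)
    then obtain part where part: "\<And>v. v \<in> V \<Longrightarrow> part v \<in> P \<and> to_nat v \<in> part v"
      by metis
    have "(\<lambda>v. g (part v)) ` V \<subseteq> {..<c}"
    proof
      fix i assume "i \<in> (\<lambda>v. g (part v)) ` V"
      then have "i \<in> g ` P" using part by blast
      then show "i \<in> {..<c}" using g le card by (auto simp: bij_betw_def)
    qed
    moreover have "\<not> (g (part p) = g (part q) \<and> g (part q) = g (part r))"
      if "dicycle3 E p q r" for p q r
    proof
      assume same: "g (part p) = g (part q) \<and> g (part q) = g (part r)"
      have pqr: "(p, q) \<in> E" "(q, r) \<in> E" "(r, p) \<in> E" "p \<in> V" "q \<in> V" "r \<in> V"
        using that E(1) by (auto simp: dicycle3_def)
      moreover have "inj_on g P" using g by (simp add: bij_betw_def)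
      ultimately have eq: "part q = part p" "part r = part p"
        using same part by (metis inj_onD)+
      let ?R = "arcs_ends (with_proj D \<restriction> part p)"
      have "to_nat p \<in> part p" "to_nat q \<in> part p" "to_nat r \<in> part p"
        using part pqr eq by metis+
      then have "(to_nat p, to_nat q) \<in> ?R" "(to_nat q, to_nat r) \<in> ?R" "(to_nat r, to_nat p) \<in> ?R"
        using pqr arc by (force simp: arcs_ends_conv)+
      then have "(to_nat p, to_nat p) \<in> ?R\<^sup>+"
        by (meson trancl.simps)
      then show False
        using acyc part pqr by (auto simp: acyclic_def)
    qed
    ultimately show "\<exists>f. f ` V \<subseteq> {..<c} \<and>
        (\<forall>p q r. dicycle3 E p q r \<longrightarrow> \<not> (f p = f q \<and> f q = f r))"
      by blast
  qed
qed

section \<open>An iterated cyclic tournament\<close>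

text \<open>
  A list stands for its path in a recursive decomposition: the lists of length at most \<open>n + 1\<close> form
  \<open>\<Delta>(1, D, D)\<close>, where \<open>D\<close> is the tournament on the lists of length at most \<open>n\<close>.
\<close>

fun casc :: "bool list \<Rightarrow> bool list \<Rightarrow> bool" where
  "casc [] [] = False"
| "casc [] (b # y) = b"
| "casc (a # x) [] = (\<not> a)"
| "casc (a # x) (b # y) = (if a = b then casc x y else a)"

lemma casc_irrefl: "\<not> casc x x"
  by (induction x) auto

lemma casc_asym: "casc x y \<Longrightarrow> \<not> casc y x"
  by (induction x y rule: casc.induct) (auto split: if_splits)

lemma casc_total: "x \<noteq> y \<Longrightarrow> casc x y \<or> casc y x"
  by (induction x y rule: casc.induct) auto

definition casc_arcs :: "nat \<Rightarrow> bool list rel" where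
  "casc_arcs n = {(x, y). length x \<le> n \<and> length y \<le> n \<and> casc x y}"

text \<open>Induction on the number of colours. If the colour of the root occurs in both copies, the
  three vertices form a monochromatic triangle; otherwise one copy avoids that colour and is left
  with one colour fewer. The colour set \<open>C\<close> is arbitrary so that any colour can be
  removed. With no colours, the vertex \<open>[]\<close> already contradicts the assumption on
  \<open>f\<close>.\<close>

lemma casc_colouring:
  fixes f :: "bool list \<Rightarrow> 'c"
  assumes "finite C" "card C \<le> n" "f ` {x. length x \<le> n} \<subseteq> C"
  shows "\<exists>p q r. dicycle3 (casc_arcs n) p q r \<and> f p = f q \<and> f q = f r"
  using assms
proof (induction n arbitrary: f C)
  case 0
  then show ?case by auto
next
  case (Suc n)
  show ?case
  proof (cases "\<exists>x y. length x \<le> n \<and> length y \<le> n \<and> f (True # x) = f [] \<and> f (False # y) = f []")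
    case True
    then obtain x y where xy: "length x \<le> n" "length y \<le> n"
      "f (True # x) = f []" "f (False # y) = f []" by blast
    then have "dicycle3 (casc_arcs (Suc n)) [] (True # x) (False # y)"
      by (simp add: dicycle3_def casc_arcs_def)
    with xy show ?thesis by metis
  next
    case False
    then obtain b where b: "\<And>x. length x \<le> n \<Longrightarrow> f (b # x) \<noteq> f []"
      by metis
    have "f [] \<in> C" using Suc.prems(3) by auto
    then have "card (C - {f []}) \<le> n"
      using Suc.prems(1,2) by simp
    moreover have "(\<lambda>x. f (b # x)) ` {x. length x \<le> n} \<subseteq> C - {f []}"
      using b Suc.prems(3) by auto
    ultimately obtain p q r where "dicycle3 (casc_arcs n) p q r"
      "f (b # p) = f (b # q)" "f (b # q) = f (b # r)"
      using Suc.IH[of "C - {f []}" "\<lambda>x. f (b # x)"] Suc.prems(1) by auto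
    moreover from this have "dicycle3 (casc_arcs (Suc n)) (b # p) (b # q) (b # r)"
      by (simp add: dicycle3_def casc_arcs_def)
    ultimately show ?thesis by metis
  qed
qed

section \<open>Local absence of directed triangles, and the descent in the iterated
  tournament\<close>

definition tri_free :: "'v rel \<Rightarrow> 'v set \<Rightarrow> bool" where
  "tri_free E S \<longleftrightarrow> (\<forall>p \<in> S. \<forall>q \<in> S. \<forall>r \<in> S. \<not> dicycle3 E p q r)"

text \<open>This is what \<open>H\<close> inherits from the line graphs; in the iterated tournament
  it steers the descent.\<close>

definition locally_tri_free :: "'v rel \<Rightarrow> 'v set \<Rightarrow> bool" where
  "locally_tri_free E S \<longleftrightarrow>
     (\<forall>s \<in> S. tri_free E {v \<in> S. (v, s) \<in> E} \<and> tri_free E {v \<in> S. (s, v) \<in> E})"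

lemma locally_tri_free_iff:
  "locally_tri_free E S \<longleftrightarrow> (\<forall>s \<in> S. \<forall>p \<in> S. \<forall>q \<in> S. \<forall>r \<in> S. dicycle3 E p q r \<longrightarrow>
     \<not> ((p, s) \<in> E \<and> (q, s) \<in> E \<and> (r, s) \<in> E) \<and> \<not> ((s, p) \<in> E \<and> (s, q) \<in> E \<and> (s, r) \<in> E))"
  unfolding locally_tri_free_def tri_free_def by blast

lemma tri_free_image:
  assumes "\<And>u v. u \<in> V \<Longrightarrow> v \<in> V \<Longrightarrow> (u, v) \<in> E \<longleftrightarrow> (f u, f v) \<in> E'"
  shows "tri_free E' (f ` V) \<longleftrightarrow> tri_free E V"
    and "locally_tri_free E' (f ` V) \<longleftrightarrow> locally_tri_free E V"
  using assms by (simp_all add: tri_free_def locally_tri_free_iff dicycle3_def)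

text \<open>All arcs between two different parts among the root, the \<open>True\<close>-copy and
  the \<open>False\<close>-copy go the same way. Hence a directed triangle cannot have exactly two
  vertices in one part.\<close>

lemma casc_dicycle3_cases:
  assumes "casc p q" "casc q r" "casc r p"
  shows "(\<exists>b p' q' r'. p = b # p' \<and> q = b # q' \<and> r = b # r') \<or>
    (\<exists>x y. {p, q, r} = {[], True # x, False # y})"
  using assms by (cases p; cases q; cases r) (auto split: if_splits)

text \<open>If \<open>S\<close> meets the root and both copies, these parts give the partition.
  Otherwise a directed triangle of \<open>S\<close> lies in one copy, and any vertex of
  \<open>S\<close> outside that copy would dominate it or be dominated by it. So \<open>S\<close>
  lies inside that copy and the induction descends.\<close>

lemma casc_decomp:
  assumes "\<And>x. x \<in> S \<Longrightarrow> length x \<le> n"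
    and "\<not> tri_free {(x, y). casc x y} S"
    and "locally_tri_free {(x, y). casc x y} S"
  shows "\<exists>v A B. S = insert v (A \<union> B) \<and> A \<noteq> {} \<and> B \<noteq> {} \<and>
    (\<forall>a \<in> A. casc v a) \<and> (\<forall>a \<in> A. \<forall>b \<in> B. casc a b) \<and> (\<forall>b \<in> B. casc b v)"
  using assms
proof (induction n arbitrary: S)
  case 0
  \<comment> \<open>Only \<open>[]\<close> has length 0, so there is no arc and hence no directed
    triangle.\<close>
  have "casc x y \<Longrightarrow> x \<in> S \<Longrightarrow> y \<in> S \<Longrightarrow> False" for x y
    using 0(1)[of x] 0(1)[of y] by simp
  with 0 show ?case by (force simp: tri_free_def dicycle3_def)
next
  case (Suc n)
  let ?E = "{(x, y). casc x y}"
  define A where "A = {x \<in> S. \<exists>y. x = True # y}"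
  define B where "B = {x \<in> S. \<exists>y. x = False # y}"
  have S: "x \<in> A \<or> x \<in> B \<or> x = []" if "x \<in> S" for x
    using that by (cases x rule: list.exhaust) (auto simp: A_def B_def)
  show ?case
  proof (cases "[] \<in> S \<and> A \<noteq> {} \<and> B \<noteq> {}")
    case True
    then have "S = insert [] (A \<union> B)" using S by (auto simp: A_def B_def)
    moreover have "\<forall>a \<in> A. casc [] a" "\<forall>a \<in> A. \<forall>b \<in> B. casc a b" "\<forall>b \<in> B. casc b []"
      by (auto simp: A_def B_def)
    ultimately show ?thesis using True by blast
  next
    case False
    obtain p q r where pqr: "p \<in> S" "q \<in> S" "r \<in> S" "casc p q" "casc q r" "casc r p"
      using Suc.prems(2) unfolding tri_free_def dicycle3_def mem_Collect_eq prod.case by blast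
    have "{p, q, r} \<noteq> {[], True # x, False # y}" for x y
    proof
      assume eq: "{p, q, r} = {[], True # x, False # y}"
      have "{p, q, r} \<subseteq> S" using pqr by simp
      then have "[] \<in> S" "True # x \<in> S" "False # y \<in> S" unfolding eq by simp_all
      with False show False by (auto simp: A_def B_def)
    qed
    then obtain b p' q' r' where b: "p = b # p'" "q = b # q'" "r = b # r'"
      using casc_dicycle3_cases[OF pqr(4-6)] by metis
    have loc: "\<not> (casc p s \<and> casc q s \<and> casc r s)" "\<not> (casc s p \<and> casc s q \<and> casc s r)"
      if "s \<in> S" for s
      using Suc.prems(3) pqr that
      unfolding locally_tri_free_iff dicycle3_def mem_Collect_eq prod.case by blast+
    \<comment> \<open>The root and the other copy each see all of copy \<open>b\<close>, in
      particular the triangle, in a single direction, which \<open>loc\<close> forbids.\<close>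
    have Cons: "\<exists>y. x = b # y" if "x \<in> S" for x
    proof (cases x)
      case Nil
      then show ?thesis using loc[OF that] b by (cases b) auto
    next
      case (Cons a y)
      then show ?thesis using loc[OF that] b by (cases b; cases a) auto
    qed
    \<comment> \<open>Removing the common first letter preserves \<open>casc\<close> and lowers the
      length bound by one.\<close>
    define T where "T = {y. b # y \<in> S}"
    have ST: "S = (#) b ` T" using Cons by (auto simp: T_def)
    have "\<exists>v A B. T = insert v (A \<union> B) \<and> A \<noteq> {} \<and> B \<noteq> {} \<and>
      (\<forall>a \<in> A. casc v a) \<and> (\<forall>a \<in> A. \<forall>b \<in> B. casc a b) \<and> (\<forall>b \<in> B. casc b v)"
    proof (rule Suc.IH)
      show "length x \<le> n" if "x \<in> T" for x
        using Suc.prems(1) that by (fastforce simp: T_def)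
      have "p' \<in> T" "q' \<in> T" "r' \<in> T" "casc p' q'" "casc q' r'" "casc r' p'"
        using pqr b by (auto simp: T_def)
      then show "\<not> tri_free ?E T"
        by (auto simp: tri_free_def dicycle3_def)
      show "locally_tri_free ?E T"
        using Suc.prems(3) tri_free_image(2)[of T ?E "(#) b" ?E] by (simp add: ST)
    qed
    then obtain v A B where "T = insert v (A \<union> B)" "A \<noteq> {}" "B \<noteq> {}"
      "\<forall>a \<in> A. casc v a" "\<forall>a \<in> A. \<forall>b \<in> B. casc a b" "\<forall>b \<in> B. casc b v"
      by blast
    then show ?thesis
      by (intro exI[of _ "b # v"] exI[of _ "(#) b ` A"] exI[of _ "(#) b ` B"]) (auto simp: ST)
  qed
qed

section \<open>An orientation of the line graph of a complete graph\<close>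

text \<open>A pair \<open>(x, y)\<close> with \<open>x < y\<close> is an edge of the complete graph
  on \<open>{..<N}\<close>. Two distinct edges with a common end lie in exactly one triangle, and
  the three edges of each triangle are oriented as a directed cycle.\<close>

definition line_arcs :: "nat \<Rightarrow> (nat \<times> nat) rel" where
  "line_arcs N = (\<Union>(x, y, z) \<in> {(x, y, z). x < y \<and> y < z \<and> z < N}.
     {((x, y), (x, z)), ((x, z), (y, z)), ((y, z), (x, y))})"

definition line_verts :: "nat \<Rightarrow> (nat \<times> nat) set" where
  "line_verts N = {(x, y). x < y \<and> y < N}"

lemma line_arcs_iff:
  "((a, b), (c, d)) \<in> line_arcs N \<longleftrightarrow> a < b \<and> c < d \<and> b < N \<and> d < N \<and>
     (a = c \<and> b < d \<or> b = d \<and> a < c \<or> a = d)"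
  by (auto simp: line_arcs_def)

lemma finite_line_verts: "finite (line_verts N)"
  by (rule finite_subset[of _ "{..<N} \<times> {..<N}"]) (auto simp: line_verts_def)

text \<open>By Ramsey's theorem for triangles with \<open>c\<close> colours, some triangle of the
  complete graph has all edges of one colour, and these edges form a directed triangle.\<close>

lemma line_colouring:
  "\<exists>N. \<forall>f :: nat \<times> nat \<Rightarrow> nat. f ` line_verts N \<subseteq> {..<c} \<longrightarrow>
     (\<exists>p q r. dicycle3 (line_arcs N) p q r \<and> f p = f q \<and> f q = f r)"
proof -
  obtain N :: nat where N: "partn_lst {..<N} (replicate c (3::nat)) 2"
    using ramsey_full by blast
  show ?thesis
  proof (intro exI[of _ N] allI impI)
    fix f :: "nat \<times> nat \<Rightarrow> nat"
    assume f: "f ` line_verts N \<subseteq> {..<c}"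
    \<comment> \<open>Ramsey's theorem colours 2-element sets, while edges are coded here as
      increasing pairs.\<close>
    let ?g = "\<lambda>e. f (Min e, Max e)"
    have g: "?g \<in> nsets {..<N} 2 \<rightarrow> {..<c}"
      using f by (fastforce simp: ordered_nsets_2_eq line_verts_def)
    obtain i K where "i < length (replicate c (3::nat))"
      "K \<in> nsets {..<N} (replicate c 3 ! i)" and mono: "?g ` nsets K 2 \<subseteq> {i}"
      by (rule partn_lstE[OF N g length_replicate])
    then have "K \<in> nsets {..<N} 3" by simp
    then obtain x y z where K: "K = {x, y, z}" and xyz: "x < y" "y < z" "z < N"
      by (auto simp: ordered_nsets_3_eq)
    have "f (u, v) = i" if "u \<in> K" "v \<in> K" "u < v" for u v
    proof -
      have "{u, v} \<in> nsets K 2" using that by simp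
      then have "?g {u, v} = i" using mono by blast
      then show ?thesis using that(3) by simp
    qed
    then have "f (x, y) = i" "f (x, z) = i" "f (y, z) = i"
      using K xyz by auto
    moreover have "dicycle3 (line_arcs N) (x, y) (x, z) (y, z)"
      using xyz by (auto simp: dicycle3_def line_arcs_iff)
    ultimately show "\<exists>p q r. dicycle3 (line_arcs N) p q r \<and> f p = f q \<and> f q = f r"
      by metis
  qed
qed

text \<open>Three pairwise adjacent edges form a triangle or share an end \<open>v\<close>. The
  edges at \<open>v\<close> are ordered transitively: first those to larger vertices, then those to
  smaller ones, each in increasing order. So only triangles give directed cycles.\<close>

lemma line_dicycle3E:
  assumes "dicycle3 (line_arcs N) p q r"
  obtains x y z where "x < y" "y < z" "{p, q, r} = {(x, y), (x, z), (y, z)}"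
proof -
  obtain a b c d e f where [simp]: "p = (a, b)" "q = (c, d)" "r = (e, f)"
    by (cases p; cases q; cases r)
  have "(a = c \<and> b < d \<or> b = d \<and> a < c \<or> a = d)" "(c = e \<and> d < f \<or> d = f \<and> c < e \<or> c = f)"
    "(e = a \<and> f < b \<or> f = b \<and> e < a \<or> e = b)" "a < b" "c < d" "e < f"
    using assms by (auto simp: dicycle3_def line_arcs_iff)
  then show ?thesis
    \<comment> \<open>The three instances are the rotations of the cycle: \<open>p\<close>,
      \<open>q\<close> or \<open>r\<close> is the edge joining the two smallest vertices.\<close>
    using that[of a b d] that[of c d f] that[of e f b] by auto
qed

text \<open>An edge \<open>s\<close> meeting all three edges of a triangle contains two of its
  vertices, so it is one of those edges; but no arc joins \<open>s\<close> to itself.\<close>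

lemma line_locally_tri_free: "locally_tri_free (line_arcs N) V"
proof -
  have False if "dicycle3 (line_arcs N) p q r"
    and s: "(\<forall>t \<in> {p, q, r}. (t, s) \<in> line_arcs N) \<or> (\<forall>t \<in> {p, q, r}. (s, t) \<in> line_arcs N)" for p q r s
  proof -
    obtain x y z where *: "x < y" "y < z" "{p, q, r} = {(x, y), (x, z), (y, z)}"
      using line_dicycle3E \<open>dicycle3 _ _ _ _\<close> by metis
    obtain u v where "s = (u, v)" by (cases s)
    with s *(1,2) show False unfolding *(3) by (auto simp: line_arcs_iff)
  qed
  then show ?thesis by (fastforce simp: locally_tri_free_def tri_free_def)
qed

section \<open>Embeddings of stars and tournaments\<close>

lemma mk_symmetric_arc_iff:
  "(u, v) \<in> parcs (mk_symmetric (with_proj D)) \<longleftrightarrow> (u, v) \<in> parcs D \<or> (v, u) \<in> parcs D"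
  by (simp add: parcs_mk_symmetric Bex_def split_paired_Ex) blast

lemma oriented_starE:
  assumes "oriented_star t F"
  obtains c L where "pverts F = insert c L" "c \<notin> L" "card L = t"
    "\<And>l. l \<in> L \<Longrightarrow> (c, l) \<in> parcs F \<or> (l, c) \<in> parcs F"
    "\<And>l m. l \<in> L \<Longrightarrow> m \<in> L \<Longrightarrow> (l, m) \<notin> parcs F"
proof -
  have "complete_bipartite_digraph 1 t (with_proj (mk_symmetric (with_proj F)))"
    using assms by (simp add: oriented_star_def)
  then obtain U L where *: "pverts F = U \<union> L" "U \<inter> L = {}" "card U = 1" "card L = t"
    "parcs (mk_symmetric (with_proj F)) = U \<times> L \<union> L \<times> U"
    unfolding complete_bipartite_digraph_pair_def by auto
  then obtain c where U: "U = {c}" by (auto simp: card_1_singleton_iff)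
  have sym: "(u, v) \<in> U \<times> L \<union> L \<times> U \<longleftrightarrow> (u, v) \<in> parcs F \<or> (v, u) \<in> parcs F" for u v
    unfolding *(5)[symmetric] by (simp add: mk_symmetric_arc_iff)
  have "(c, l) \<in> parcs F \<or> (l, c) \<in> parcs F" if "l \<in> L" for l
    using that sym[of c l] by (simp add: U)
  moreover have "(l, m) \<notin> parcs F" if "l \<in> L" "m \<in> L" for l m
    using that sym[of l m] *(2) by (auto simp: U)
  ultimately show ?thesis
    using that[of c L] *(1,2,4) by (simp add: U)
qed

text \<open>The host is a tournament, whereas two leaves of a star are not adjacent.\<close>

lemma star_not_embeds_casc:
  assumes "oriented_star 4 F" and V: "V \<subseteq> {x. length x \<le> n}"
  shows "\<not> embeds F V (casc_arcs n)"
proof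
  assume "embeds F V (casc_arcs n)"
  then obtain f where f: "inj_on f (pverts F)" "f ` pverts F \<subseteq> V"
    "\<And>u v. u \<in> pverts F \<Longrightarrow> v \<in> pverts F \<Longrightarrow> (u, v) \<in> parcs F \<longleftrightarrow> (f u, f v) \<in> casc_arcs n"
    unfolding embeds_def by metis
  obtain c L where *: "pverts F = insert c L" "c \<notin> L" "card L = 4"
    "\<And>l m. l \<in> L \<Longrightarrow> m \<in> L \<Longrightarrow> (l, m) \<notin> parcs F"
    using oriented_starE[OF assms(1)] by metis
  obtain l m where lm: "l \<in> L" "m \<in> L" "l \<noteq> m"
    using *(3) by (metis One_nat_def card_1_singletonE card_le_Suc0_iff_eq card.infinite
        numeral_eq_one_iff semiring_norm(83) zero_neq_numeral le_SucE le_zero_eq linorder_not_less not_numeral_le_zero)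
  then have "f l \<noteq> f m" using f(1) *(1) by (auto dest: inj_onD)
  then have "(f l, f m) \<in> casc_arcs n \<or> (f m, f l) \<in> casc_arcs n"
    using casc_total f(2) *(1) lm V by (auto simp: casc_arcs_def)
  then show False using f(3) *(1,4) lm by auto
qed

text \<open>The image of the centre is an edge with two ends, and every leaf contains one of them.
  By the pigeonhole principle two leaves share an end and are therefore adjacent.\<close>

lemma star_not_embeds_line:
  assumes "oriented_star 4 F"
  shows "\<not> embeds F (line_verts N) (line_arcs N)"
proof
  assume "embeds F (line_verts N) (line_arcs N)"
  then obtain f where f: "inj_on f (pverts F)" "f ` pverts F \<subseteq> line_verts N"
    "\<And>u v. u \<in> pverts F \<Longrightarrow> v \<in> pverts F \<Longrightarrow> (u, v) \<in> parcs F \<longleftrightarrow> (f u, f v) \<in> line_arcs N"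
    unfolding embeds_def by metis
  obtain c L where *: "pverts F = insert c L" "c \<notin> L" "card L = 4"
    "\<And>l. l \<in> L \<Longrightarrow> (c, l) \<in> parcs F \<or> (l, c) \<in> parcs F"
    "\<And>l m. l \<in> L \<Longrightarrow> m \<in> L \<Longrightarrow> (l, m) \<notin> parcs F"
    using oriented_starE[OF assms] by metis
  define ends where "ends = (\<lambda>l. {fst (f l), snd (f l)})"
  have adj: "(f l, f m) \<in> line_arcs N \<or> (f m, f l) \<in> line_arcs N \<longleftrightarrow> ends l \<inter> ends m \<noteq> {}"
    if "l \<in> pverts F" "m \<in> pverts F" "l \<noteq> m" for l m
  proof -
    have "f l \<in> line_verts N" "f m \<in> line_verts N" "f l \<noteq> f m"
      using f(1,2) that by (auto dest: inj_onD)
    then show ?thesis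
      by (cases "f l"; cases "f m") (auto simp: line_verts_def line_arcs_iff ends_def)
  qed
  have "ends l \<inter> ends c \<noteq> {}" if "l \<in> L" for l
    using adj[of l c] * f(3) that by auto
  then have "\<forall>l \<in> L. \<exists>w \<in> ends c. w \<in> ends l" by blast
  then obtain w where w: "\<And>l. l \<in> L \<Longrightarrow> w l \<in> ends c \<and> w l \<in> ends l" by metis
  have "card (w ` L) \<le> card (ends c)"
    using w by (intro card_mono) (auto simp: ends_def)
  also have "\<dots> \<le> 2" by (simp add: ends_def card_insert_le_m1)
  finally have "\<not> inj_on w L" using *(3) card_image[of w L] by linarith
  then obtain l m where lm: "l \<in> L" "m \<in> L" "l \<noteq> m" "w l = w m" by (auto simp: inj_on_def)
  then have "ends l \<inter> ends m \<noteq> {}" using w by (metis disjoint_iff)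
  then have "(l, m) \<in> parcs F \<or> (m, l) \<in> parcs F"
    using adj[of l m] f(3) *(1) lm by auto
  then show False using *(5) lm by blast
qed

text \<open>Without directed triangles a tournament is transitive, and the in-degree within
  \<open>A\<close> is then its ranking.\<close>

lemma transitive_ranking:
  assumes "finite A" and "\<And>x y. x \<in> A \<Longrightarrow> y \<in> A \<Longrightarrow> x \<noteq> y \<Longrightarrow> (x, y) \<in> E \<or> (y, x) \<in> E"
    and "irrefl E" "antisym E" "tri_free E A"
  shows "\<exists>h. bij_betw h A {..<card A} \<and> (\<forall>x \<in> A. \<forall>y \<in> A. (x, y) \<in> E \<longleftrightarrow> h x < h y)"
proof -
  define h where "h x = card {y \<in> A. (y, x) \<in> E}" for x
  have irr: "(x, x) \<notin> E" for x using assms(3) by (auto simp: irrefl_def)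
  have trans: "(x, z) \<in> E" if "(x, y) \<in> E" "(y, z) \<in> E" "x \<in> A" "y \<in> A" "z \<in> A" for x y z
  proof (rule ccontr)
    assume "(x, z) \<notin> E"
    then have "x = z \<or> (z, x) \<in> E" using that assms(2) by blast
    then show False
      using that assms(5) antisymD[OF assms(4), of x y] irr
      unfolding tri_free_def dicycle3_def by blast
  qed
  have less: "h x < h y" if "(x, y) \<in> E" "x \<in> A" "y \<in> A" for x y
  proof -
    \<comment> \<open>Inclusion is transitivity; it is strict because \<open>x\<close> belongs only
      to the right-hand set.\<close>
    have "{z \<in> A. (z, x) \<in> E} \<subset> {z \<in> A. (z, y) \<in> E}"
      using that trans irr by blast
    then show ?thesis unfolding h_def using assms(1) by (intro psubset_card_mono) auto
  qed
  have inj: "inj_on h A"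
    by (rule inj_onI) (metis assms(2) less nat_neq_iff)
  have "h ` A \<subseteq> {..<card A}"
  proof
    fix i assume "i \<in> h ` A"
    then obtain x where "x \<in> A" "i = h x" by blast
    moreover from this have "{z \<in> A. (z, x) \<in> E} \<subset> A" using irr by blast
    ultimately show "i \<in> {..<card A}"
      unfolding h_def using assms(1) by (auto intro: psubset_card_mono)
  qed
  then have "h ` A = {..<card A}"
    using inj by (intro card_subset_eq) (auto simp: card_image)
  moreover have "(x, y) \<in> E \<longleftrightarrow> h x < h y" if "x \<in> A" "y \<in> A" for x y
    using that less[of x y] less[of y x] assms(2)[of x y] by fastforce
  ultimately show ?thesis using inj unfolding bij_betw_def by blast
qed

text \<open>If \<open>H\<close> embedded in no member of the family, a single \<open>c\<close> would
  colour every member without a monochromatic directed triangle, against \<open>col\<close> for this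
  \<open>c\<close>.\<close>

lemma embeds_of_colouring:
  fixes V :: "nat \<Rightarrow> 'v::countable set"
  assumes "dichi_finite {H, F}"
    and dig: "\<And>n. finite (V n)" "\<And>n. E n \<subseteq> V n \<times> V n" "\<And>n. irrefl (E n)" "\<And>n. antisym (E n)"
    and star: "\<And>n. \<not> embeds F (V n) (E n)"
    and col: "\<And>c. \<exists>n. \<forall>f :: 'v \<Rightarrow> nat. f ` V n \<subseteq> {..<c} \<longrightarrow>
      (\<exists>p q r. dicycle3 (E n) p q r \<and> f p = f q \<and> f q = f r)"
  shows "\<exists>n. embeds H (V n) (E n)"
proof -
  obtain c where c: "\<exists>f. f ` V n \<subseteq> {..<c :: nat} \<and>
      (\<forall>p q r. dicycle3 (E n) p q r \<longrightarrow> \<not> (f p = f q \<and> f q = f r))"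
    if "\<not> embeds H (V n) (E n)" for n
  proof -
    from dichi_finite_colouring[OF assms(1)]
    obtain c where c: "\<forall>(V :: 'v set) E. finite V \<longrightarrow> E \<subseteq> V \<times> V \<longrightarrow> irrefl E \<longrightarrow> antisym E \<longrightarrow>
      (\<forall>H \<in> {H, F}. \<not> embeds H V E) \<longrightarrow>
      (\<exists>f. f ` V \<subseteq> {..<c :: nat} \<and>
        (\<forall>p q r. dicycle3 E p q r \<longrightarrow> \<not> (f p = f q \<and> f q = f r)))" ..
    show thesis
      by (rule that[of c], rule c[rule_format]) (use dig star in auto)
  qed
  from col[of c] obtain n where n: "\<forall>f. f ` V n \<subseteq> {..<c} \<longrightarrow>
      (\<exists>p q r. dicycle3 (E n) p q r \<and> f p = f q \<and> f q = f r)" ..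
  have "embeds H (V n) (E n)"
  proof (rule ccontr)
    assume "\<not> embeds H (V n) (E n)"
    from c[OF this] obtain f where f: "f ` V n \<subseteq> {..<c}"
      "\<And>p q r. dicycle3 (E n) p q r \<Longrightarrow> \<not> (f p = f q \<and> f q = f r)"
      by metis
    with n[rule_format, OF f(1)] show False by metis
  qed
  then show ?thesis ..
qed

section \<open>Embedding \<open>H\<close> in a member of each family\<close>

lemma embeds_casc:
  assumes "dichi_finite {H, F}" "oriented_star 4 F"
  shows "\<exists>n. embeds H {x. length x \<le> n} (casc_arcs n)"
proof (rule embeds_of_colouring[OF assms(1)])
  fix n
  have "{x :: bool list. length x \<le> n} = {x. set x \<subseteq> UNIV \<and> length x \<le> n}" by simp
  then show "finite {x :: bool list. length x \<le> n}"
    using finite_lists_length_le[of "UNIV :: bool set" n] by simp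
  show "casc_arcs n \<subseteq> {x. length x \<le> n} \<times> {x. length x \<le> n}"
    by (auto simp: casc_arcs_def)
  show "irrefl (casc_arcs n)"
    by (auto simp: irrefl_def casc_arcs_def casc_irrefl)
  show "antisym (casc_arcs n)"
    by (auto simp: antisym_def casc_arcs_def dest: casc_asym)
  show "\<not> embeds F {x. length x \<le> n} (casc_arcs n)"
    using star_not_embeds_casc[OF assms(2)] by simp
next
  fix c
  show "\<exists>n. \<forall>f :: bool list \<Rightarrow> nat. f ` {x. length x \<le> n} \<subseteq> {..<c} \<longrightarrow>
      (\<exists>p q r. dicycle3 (casc_arcs n) p q r \<and> f p = f q \<and> f q = f r)"
    using casc_colouring[of "{..<c}" c] by (intro exI[of _ c]) auto
qed

lemma embeds_line:
  assumes "dichi_finite {H, F}" "oriented_star 4 F"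
  shows "\<exists>N. embeds H (line_verts N) (line_arcs N)"
proof (rule embeds_of_colouring[OF assms(1) finite_line_verts])
  fix N
  show "line_arcs N \<subseteq> line_verts N \<times> line_verts N"
    by (auto simp: line_verts_def line_arcs_iff)
  show "irrefl (line_arcs N)"
    by (auto simp: irrefl_def line_arcs_iff)
  show "antisym (line_arcs N)"
    by (auto simp: antisym_def line_arcs_iff)
  show "\<not> embeds F (line_verts N) (line_arcs N)"
    using star_not_embeds_line[OF assms(2)] .
qed (rule line_colouring)

section \<open>Recognising the two possible shapes of \<open>H\<close>\<close>

lemma transitive_tournamentI:
  assumes H: "oriented_digraph H"
    and total: "\<And>x y. x \<in> pverts H \<Longrightarrow> y \<in> pverts H \<Longrightarrow> x \<noteq> y \<Longrightarrow> (x, y) \<in> parcs H \<or> (y, x) \<in> parcs H"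
    and "tri_free (parcs H) (pverts H)"
  shows "transitive_tournament H"
proof -
  interpret pair_digraph H using H by (simp add: oriented_digraph_def)
  have "irrefl (parcs H)" using pair_no_loops by (force simp: irrefl_def)
  moreover have "antisym (parcs H)" using H by (simp add: oriented_digraph_def)
  ultimately obtain h :: "_ \<Rightarrow> nat" where h: "(x, y) \<in> parcs H \<longleftrightarrow> h x < h y"
    if "x \<in> pverts H" "y \<in> pverts H" for x y
    using transitive_ranking[OF pair_finite_verts total _ _ assms(3)] by metis
  have sub: "parcs H \<subseteq> pverts H \<times> pverts H"
    using in_arcsD1 in_arcsD2 by auto
  \<comment> \<open>Along every arc the rank increases, so no cycle can close.\<close>
  then have "parcs H \<subseteq> inv_image less_than h"
    using h by auto
  then have "acyclic (parcs H)"
    by (meson acyclic_subset wf_acyclic wf_inv_image wf_less_than)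
  moreover have "parcs (mk_symmetric (with_proj H)) = {(u, v). u \<in> pverts H \<and> v \<in> pverts H \<and> u \<noteq> v}"
    using sub total \<open>irrefl (parcs H)\<close> by (auto simp: mk_symmetric_arc_iff irrefl_def)
  then have "complete_digraph (card (pverts H)) (with_proj (mk_symmetric (with_proj H)))"
    using pair_finite_verts by (auto simp: complete_digraph_pair_def)
  ultimately show ?thesis
    using H by (auto simp: transitive_tournament_def tournament_def)
qed

text \<open>\<open>A\<close> and \<open>B\<close> are sent to transitive tournaments by their
  rankings, and \<open>v\<close> to the single vertex of \<open>TT 1\<close>.\<close>

lemma digraph_iso_Delta_TT:
  assumes H: "oriented_digraph H"
    and verts: "pverts H = insert v (A \<union> B)"
    and total: "\<And>x y. x \<in> pverts H \<Longrightarrow> y \<in> pverts H \<Longrightarrow> x \<noteq> y \<Longrightarrow> (x, y) \<in> parcs H \<or> (y, x) \<in> parcs H"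
    and arcs: "\<And>a. a \<in> A \<Longrightarrow> (v, a) \<in> parcs H"
      "\<And>a b. a \<in> A \<Longrightarrow> b \<in> B \<Longrightarrow> (a, b) \<in> parcs H" "\<And>b. b \<in> B \<Longrightarrow> (b, v) \<in> parcs H"
    and "tri_free (parcs H) A" "tri_free (parcs H) B"
  shows "digraph_iso (with_proj H) (with_proj (Delta (TT 1) (TT (card A)) (TT (card B))))"
proof -
  interpret pair_digraph H using H by (simp add: oriented_digraph_def)
  let ?E = "parcs H"
  have irr: "irrefl ?E" using pair_no_loops by (force simp: irrefl_def)
  have anti: "antisym ?E" using H by (simp add: oriented_digraph_def)
  have fin: "finite A" "finite B" using pair_finite_verts by (simp_all add: verts)
  obtain h where h: "bij_betw h A {..<card A}"
    and hE: "\<And>x y. x \<in> A \<Longrightarrow> y \<in> A \<Longrightarrow> (x, y) \<in> ?E \<longleftrightarrow> h x < h y"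
    using transitive_ranking[OF fin(1) _ irr anti \<open>tri_free ?E A\<close>] total verts by blast
  obtain k where k: "bij_betw k B {..<card B}"
    and kE: "\<And>x y. x \<in> B \<Longrightarrow> y \<in> B \<Longrightarrow> (x, y) \<in> ?E \<longleftrightarrow> k x < k y"
    using transitive_ranking[OF fin(2) _ irr anti \<open>tri_free ?E B\<close>] total verts by blast
  have loop: "(x, x) \<notin> ?E" for x using irr by (simp add: irrefl_def)
  have rev: "(y, x) \<notin> ?E" if "(x, y) \<in> ?E" for x y
    using that anti loop by (auto simp: antisym_def)
  \<comment> \<open>A common element of two of the parts would carry a loop.\<close>
  have disj: "v \<notin> A" "v \<notin> B" "A \<inter> B = {}"
    using arcs loop by blast+
  define g :: "'a \<Rightarrow> nat + nat + nat" where
    "g x = (if x = v then Inl 0 else if x \<in> A then Inr (Inl (h x)) else Inr (Inr (k x)))" for x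
  have gv: "g v = Inl 0" by (simp add: g_def)
  have gA: "g x = Inr (Inl (h x))" if "x \<in> A" for x using that disj by (auto simp: g_def)
  have gB: "g x = Inr (Inr (k x))" if "x \<in> B" for x using that disj by (auto simp: g_def)
  have hlt: "h x < card A" if "x \<in> A" for x using h that by (auto simp: bij_betw_def)
  have klt: "k x < card B" if "x \<in> B" for x using k that by (auto simp: bij_betw_def)
  let ?D = "Delta (TT 1) (TT (card A)) (TT (card B))"
  have Dv: "pverts ?D = insert (Inl 0) ((Inr \<circ> Inl) ` {..<card A} \<union> (Inr \<circ> Inr) ` {..<card B})"
    by (auto simp: Delta_def TT_def Let_def)
  \<comment> \<open>One entry for each ordered pair of parts, so that the case analysis on
    \<open>x\<close> and \<open>y\<close> below becomes rewriting.\<close>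
  have Da: "(Inl 0, Inl 0) \<notin> parcs ?D"
    "(Inl 0, Inr (Inl i)) \<in> parcs ?D \<longleftrightarrow> i < card A"
    "(Inl 0, Inr (Inr j)) \<notin> parcs ?D"
    "(Inr (Inl i), Inl 0) \<notin> parcs ?D"
    "(Inr (Inl i), Inr (Inl i')) \<in> parcs ?D \<longleftrightarrow> i < i' \<and> i' < card A"
    "(Inr (Inl i), Inr (Inr j)) \<in> parcs ?D \<longleftrightarrow> i < card A \<and> j < card B"
    "(Inr (Inr j), Inl 0) \<in> parcs ?D \<longleftrightarrow> j < card B"
    "(Inr (Inr j), Inr (Inl i)) \<notin> parcs ?D"
    "(Inr (Inr j), Inr (Inr j')) \<in> parcs ?D \<longleftrightarrow> j < j' \<and> j' < card B" for i i' j j'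
    by (auto simp: Delta_def TT_def Let_def image_iff Bex_def split_paired_Ex)
  have "inj_on g (pverts H)"
    using h k disj by (auto simp: verts inj_on_def bij_betw_def gv gA gB)
  moreover have "g ` pverts H = pverts ?D"
  proof -
    have "g ` A = (Inr \<circ> Inl) ` h ` A" "g ` B = (Inr \<circ> Inr) ` k ` B"
      by (auto simp: gA gB image_iff)
    then show ?thesis
      using h k by (simp add: verts Dv gv image_Un bij_betw_def del: One_nat_def)
  qed
  ultimately have bij: "bij_betw g (pverts H) (pverts ?D)" by (simp add: bij_betw_def)
  have "(x, y) \<in> ?E \<longleftrightarrow> (g x, g y) \<in> parcs ?D" if "x \<in> pverts H" "y \<in> pverts H" for x y
  proof -
    have "x = v \<or> x \<in> A \<or> x \<in> B" "y = v \<or> y \<in> A \<or> y \<in> B" using that by (auto simp: verts)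
    then show ?thesis
      using arcs rev loop by (elim disjE) (simp_all add: gv gA gB Da hE kE hlt klt del: One_nat_def)
  qed
  moreover have "parcs ?D \<subseteq> pverts ?D \<times> pverts ?D"
    by (auto simp: Delta_def TT_def Let_def)
  ultimately show ?thesis
    using digraph_isoI[OF _ bij] pair_wf_digraph_axioms by blast
qed

theorem theorem1p6:
  fixes F H :: "'a pair_pre_digraph"
  assumes "oriented_star 4 F"
    and "oriented_digraph H"
    and "dichi_finite {H, F}"
  shows "transitive_tournament H \<or>
    (\<exists>m m'. m \<ge> 1 \<and> m' \<ge> 1 \<and>
      digraph_iso (with_proj H) (with_proj (Delta (TT 1) (TT m) (TT m'))))"
proof -
  let ?V = "pverts H" and ?E = "parcs H" and ?C = "{(x, y). casc x y}"
  interpret pair_digraph H using assms(2) by (simp add: oriented_digraph_def)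
  obtain n f where inj: "inj_on f ?V" and len: "f ` ?V \<subseteq> {x. length x \<le> n}"
    and f: "\<And>u v. u \<in> ?V \<Longrightarrow> v \<in> ?V \<Longrightarrow> (u, v) \<in> ?E \<longleftrightarrow> (f u, f v) \<in> casc_arcs n"
    using embeds_casc[OF assms(3,1)] unfolding embeds_def by metis
  have fE: "(u, v) \<in> ?E \<longleftrightarrow> casc (f u) (f v)" if "u \<in> ?V" "v \<in> ?V" for u v
    using that f len by (auto simp: casc_arcs_def)
  \<comment> \<open>The first family consists of tournaments, so \<open>H\<close> is one.\<close>
  have total: "(x, y) \<in> ?E \<or> (y, x) \<in> ?E" if "x \<in> ?V" "y \<in> ?V" "x \<noteq> y" for x y
    using that fE casc_total[of "f x" "f y"] inj by (auto dest: inj_onD)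
  obtain N g where "g ` ?V \<subseteq> line_verts N"
    and g: "\<And>u v. u \<in> ?V \<Longrightarrow> v \<in> ?V \<Longrightarrow> (u, v) \<in> ?E \<longleftrightarrow> (g u, g v) \<in> line_arcs N"
    using embeds_line[OF assms(3,1)] unfolding embeds_def by metis
  \<comment> \<open>The local condition passes from the line graph to \<open>H\<close>, and from
    there to the image of \<open>H\<close> under \<open>f\<close>.\<close>
  have loc: "locally_tri_free ?E ?V"
    using line_locally_tri_free[of N "g ` ?V"]
      tri_free_image(2)[of ?V ?E g "line_arcs N"] g by blast
  show ?thesis
  proof (cases "tri_free ?E ?V")
    case True
    then show ?thesis using transitive_tournamentI[OF assms(2) total] by blast
  next
    case False
    have "\<exists>v A B. f ` ?V = insert v (A \<union> B) \<and> A \<noteq> {} \<and> B \<noteq> {} \<and>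
      (\<forall>a \<in> A. casc v a) \<and> (\<forall>a \<in> A. \<forall>b \<in> B. casc a b) \<and> (\<forall>b \<in> B. casc b v)"
    proof (rule casc_decomp)
      show "length x \<le> n" if "x \<in> f ` ?V" for x using that len by blast
      show "\<not> tri_free ?C (f ` ?V)"
        using False tri_free_image(1)[of ?V ?E f ?C] fE by simp
      show "locally_tri_free ?C (f ` ?V)"
        using loc tri_free_image(2)[of ?V ?E f ?C] fE by simp
    qed
    then obtain w A' B' where img: "f ` ?V = insert w (A' \<union> B')" and ne: "A' \<noteq> {}" "B' \<noteq> {}"
      and arcs: "\<And>a. a \<in> A' \<Longrightarrow> casc w a" "\<And>a b. a \<in> A' \<Longrightarrow> b \<in> B' \<Longrightarrow> casc a b"
        "\<And>b. b \<in> B' \<Longrightarrow> casc b w"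
      by metis
    \<comment> \<open>The partition of the image is pulled back along the injection
      \<open>f\<close>.\<close>
    define A where "A = {x \<in> ?V. f x \<in> A'}"
    define B where "B = {x \<in> ?V. f x \<in> B'}"
    have "w \<in> f ` ?V" using img by simp
    then obtain v where v: "v \<in> ?V" "f v = w" by blast
    have verts: "?V = insert v (A \<union> B)"
    proof -
      have "x = v" if "x \<in> ?V" "f x = w" for x
        using that v inj by (auto dest: inj_onD)
      moreover have "f x = w \<or> f x \<in> A' \<or> f x \<in> B'" if "x \<in> ?V" for x
        using that img by blast
      ultimately show ?thesis using v(1) by (auto simp: A_def B_def)
    qed
    have E: "\<And>a. a \<in> A \<Longrightarrow> (v, a) \<in> ?E" "\<And>a b. a \<in> A \<Longrightarrow> b \<in> B \<Longrightarrow> (a, b) \<in> ?E"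
      "\<And>b. b \<in> B \<Longrightarrow> (b, v) \<in> ?E"
      using arcs v fE by (auto simp: A_def B_def)
    \<comment> \<open>\<open>A\<close> and \<open>B\<close> lie in the out- and in-neighbourhood of
      \<open>v\<close>, so \<open>loc\<close> at \<open>v\<close> makes both free of directed
      triangles.\<close>
    have "A \<subseteq> {x \<in> ?V. (v, x) \<in> ?E}" "B \<subseteq> {x \<in> ?V. (x, v) \<in> ?E}"
      using E by (auto simp: A_def B_def)
    then have "tri_free ?E A" "tri_free ?E B"
      using loc v(1) unfolding locally_tri_free_def tri_free_def by (meson subsetD)+
    then have iso: "digraph_iso (with_proj H) (with_proj (Delta (TT 1) (TT (card A)) (TT (card B))))"
      using digraph_iso_Delta_TT[OF assms(2) verts total E] by blast
    have "finite A" "finite B"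
      using pair_finite_verts by (simp_all add: A_def B_def)
    moreover have "A' \<subseteq> f ` ?V" "B' \<subseteq> f ` ?V" using img by auto
    then have "A \<noteq> {}" "B \<noteq> {}"
      using ne by (fastforce simp: A_def B_def)+
    ultimately have "card A \<ge> 1" "card B \<ge> 1"
      by (simp_all add: Suc_le_eq card_gt_0_iff)
    with iso show ?thesis by blast
  qed
qed

end
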